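(* Let $m\ge 2$ and let $S=\langle m,s+1,s+2,\dots,s+m-1\rangle$ be an Arf numerical semigroup with multiplicity $m$ and conductor $s$, where $s\equiv 0 \bmod m$. Then $\mathrm{PF}(S)=\{s-m+1,s-m+2,\dots,s-1\}$, and for each $k\in\{1,\dots,m-1\}$ the pseudo-Frobenius number $s-k$ has a row-factorization matrix $(a_{ij})_{m\times m}$ (with respect to the generators in increasing order $m,s+1,\dots,s+m-1$) given by \[ a_{ij}=\begin{cases} -1 & i=j,\\ 1 & i=1,\ j=m-k+1,\\ \frac{2s}{m} & i=k+1,\ j=1,\\ \frac{s-m}{m} & 1<i<k+1,\ j=1,\\ 1 & 1<i<k+1,\ j=i+m-k,\\ \frac{s}{m} & i>k+1,\ j=1,\\ 1 & i>k+1,\ j=i-k,\\ 0 & \text{otherwise.} \end{cases} \]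
   Context: A numerical semigroup is a subset $S\subseteq\mathbb{N}_0$ (non-negative integers) containing $0$, closed under addition, with finite complement in $\mathbb{N}_0$; $\langle A\rangle$ is the set of $\mathbb{N}_0$-linear combinations of elements of $A$. The multiplicity is the smallest nonzero element of $S$; the Frobenius number $F(S)$ is the greatest integer not in $S$; the conductor is $F(S)+1$. $S$ is Arf if $s_2+s_3-s_1\in S$ for all $s_1\le s_2\le s_3$ in $S$. $\mathrm{PF}(S)$ is the set of pseudo-Frobenius numbers: integers $z\notin S$ with $z+x\in S$ for all nonzero $x\in S$. If $n_1<\dots<n_e$ are the minimal generators of $S$, a row-factorization matrix of $f\in\mathrm{PF}(S)$ is an $e\times e$ integer matrix $[a_{ij}]$ with $a_{ii}=-1$, $a_{ij}\in\mathbb{N}_0$ for $i\ne j$, and $f=\sum_{j=1}^e a_{ij}n_j$ for each $i$. *)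

theory Defs
  imports Main "Jordan_Normal_Form.Matrix"
begin

definition numerical_semigroup :: "nat set \<Rightarrow> bool" where
  "numerical_semigroup S \<longleftrightarrow> 0 \<in> S \<and> (\<forall>x\<in>S. \<forall>y\<in>S. x + y \<in> S) \<and> finite (- S)"

definition nat_span :: "nat set \<Rightarrow> nat set" where
  "nat_span A = {\<Sum>a\<in>B. c a * a | B c. finite B \<and> B \<subseteq> A}"

definition nsg_multiplicity :: "nat set \<Rightarrow> nat" where
  "nsg_multiplicity S = (LEAST x. x \<in> S \<and> x \<noteq> 0)"

text \<open>The Frobenius number is the greatest \<^emph>\<open>integer\<close> outside \<open>S\<close>; it is \<open>-1\<close> when \<open>S\<close> is
  everything.\<close>

definition frobenius_number :: "nat set \<Rightarrow> int" where
  "frobenius_number S = (GREATEST z. z \<notin> int ` S)"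

definition conductor :: "nat set \<Rightarrow> int" where
  "conductor S = frobenius_number S + 1"

text \<open>The subtraction below does not truncate, since \<open>s1 \<le> s2\<close>.\<close>

definition arf :: "nat set \<Rightarrow> bool" where
  "arf S \<longleftrightarrow> (\<forall>s1\<in>S. \<forall>s2\<in>S. \<forall>s3\<in>S. s1 \<le> s2 \<and> s2 \<le> s3 \<longrightarrow> s2 + s3 - s1 \<in> S)"

definition pseudo_frobenius :: "nat set \<Rightarrow> int set" where
  "pseudo_frobenius S =
     {z. z \<notin> int ` S \<and> (\<forall>x\<in>S. x \<noteq> 0 \<longrightarrow> z + int x \<in> int ` S)}"

text \<open>\<open>ns\<close> lists the minimal generators \<open>n\<^sub>1 < \<dots> < n\<^sub>e\<close> of \<open>S\<close> in increasing order.\<close>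

definition minimal_generators :: "nat set \<Rightarrow> nat list \<Rightarrow> bool" where
  "minimal_generators S ns \<longleftrightarrow>
     sorted_wrt (<) ns \<and> nat_span (set ns) = S \<and> (\<forall>B. B \<subset> set ns \<longrightarrow> nat_span B \<noteq> S)"

text \<open>Matrix and list indices start at \<open>0\<close>, so \<open>ns ! j\<close> is \<open>n\<^sub>j\<^sub>+\<^sub>1\<close>.\<close>

definition row_factorization_matrix :: "nat set \<Rightarrow> nat list \<Rightarrow> int \<Rightarrow> int mat \<Rightarrow> bool" where
  "row_factorization_matrix S ns f A \<longleftrightarrow>
     minimal_generators S ns \<and> f \<in> pseudo_frobenius S \<and>
     A \<in> carrier_mat (length ns) (length ns) \<and>
     (\<forall>i < length ns.
        A $$ (i, i) = -1 \<and>
        (\<forall>j < length ns. j \<noteq> i \<longrightarrow> A $$ (i, j) \<ge> 0) \<and>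
        f = (\<Sum>j < length ns. A $$ (i, j) * int (ns ! j)))"

text \<open>Here \<open>i\<close> and \<open>j\<close> start at \<open>1\<close>. The divisions are exact when \<open>m dvd s\<close>, and the cases
  are mutually exclusive for \<open>1 \<le> k < m\<close>.\<close>

definition rf_entry :: "nat \<Rightarrow> nat \<Rightarrow> nat \<Rightarrow> nat \<Rightarrow> nat \<Rightarrow> int" where
  "rf_entry m s k i j =
     (if i = j then -1
      else if i = 1 \<and> j = m - k + 1 then 1
      else if i = k + 1 \<and> j = 1 then (2 * int s) div int m
      else if 1 < i \<and> i < k + 1 \<and> j = 1 then (int s - int m) div int m
      else if 1 < i \<and> i < k + 1 \<and> j = i + m - k then 1
      else if i > k + 1 \<and> j = 1 then int s div int m
      else if i > k + 1 \<and> j = i - k then 1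
      else 0)"

definition rf_mat :: "nat \<Rightarrow> nat \<Rightarrow> nat \<Rightarrow> int mat" where
  "rf_mat m s k = mat m m (\<lambda>(i, j). rf_entry m s k (i + 1) (j + 1))"

end

theory Submission imports Defs begin

text \<open>
  Everything rests on an explicit description of \<open>S\<close>: the given generators produce exactly the
  multiples of \<open>m\<close> together with all integers \<open>\<ge> s\<close>
  (\<open>nat_span_interval_generators\<close>). Since \<open>m\<close> is the multiplicity, \<open>s = 0\<close> is
  impossible, as \<open>1\<close> would then be a generator; hence \<open>s\<close> is a positive multiple of \<open>m\<close>.

  For the pseudo-Frobenius numbers, the integers strictly between \<open>s - m\<close> and \<open>s\<close> are
  non-multiples of \<open>m\<close>, hence gaps, and adding any nonzero element of \<open>S\<close>, which is at least
  \<open>m\<close>, lifts them above \<open>s\<close>. Conversely, if \<open>z\<close> is pseudo-Frobenius then \<open>z + m\<close> is in \<open>S\<close>; when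
  it is not a multiple of \<open>m\<close> it exceeds \<open>s\<close>, and the only gap \<open>z\<close> for which it is a multiple is
  \<open>-m\<close>, which adding \<open>s + 1\<close> rules out.

  The generators are minimal because none is a sum of two nonzero elements of \<open>S\<close>
  (\<open>irreducible_notin_nat_span\<close>). Finally, with \<open>n\<^sub>1 = m\<close> and \<open>n\<^sub>j = s + j - 1\<close> for
  \<open>j \<ge> 2\<close>, the rows of the matrix express, according to the position of \<open>i\<close>, the identities
  \<open>s - k = n\<^bsub>m-k+1\<^esub> - m\<close>, \<open>s - k = (s - m) + n\<^bsub>i+m-k\<^esub> - n\<^sub>i\<close>,
  \<open>s - k = 2 s - n\<^bsub>k+1\<^esub>\<close> and \<open>s - k = s + n\<^bsub>i-k\<^esub> - n\<^sub>i\<close>, where \<open>s\<close>, \<open>s - m\<close> and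
  \<open>2 s\<close> are read as multiples of the generator \<open>m\<close>.
\<close>

lemma generator_in_nat_span:
  assumes "a \<in> A" shows "a \<in> nat_span A"
proof -
  have "a = (\<Sum>b\<in>{a}. (1::nat) * b)" by simp
  then show ?thesis
    unfolding nat_span_def using assms
    by (intro CollectI exI[of _ "{a}"] exI[of _ "\<lambda>_. 1"]) simp
qed

lemma multiple_in_additive_set:
  fixes T :: "nat set"
  assumes "0 \<in> T" "\<And>x y. x \<in> T \<Longrightarrow> y \<in> T \<Longrightarrow> x + y \<in> T" "a \<in> T"
  shows "n * a \<in> T"
  using assms by (induction n) auto

lemma nat_span_least:
  assumes "A \<subseteq> T" "0 \<in> T" "\<And>x y. x \<in> T \<Longrightarrow> y \<in> T \<Longrightarrow> x + y \<in> T"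
  shows "nat_span A \<subseteq> T"
proof
  fix x assume "x \<in> nat_span A"
  then obtain B c where B: "finite B" "B \<subseteq> A" and x: "x = (\<Sum>a\<in>B. c a * a)"
    unfolding nat_span_def by blast
  from B have "(\<Sum>a\<in>B. c a * a) \<in> T"
  proof (induction B rule: finite_induct)
    case empty
    then show ?case using assms(2) by simp
  next
    case (insert a F)
    then have "c a * a \<in> T"
      using multiple_in_additive_set[OF assms(2,3)] assms(1) by blast
    then show ?case using insert assms(3) by auto
  qed
  then show "x \<in> T" using x by simp
qed

text \<open>The reason is that \<open>S - {g}\<close> is again closed under addition. Applied to each generator in
  turn, this gives minimality of a generating set.\<close>

lemma irreducible_notin_nat_span:
  assumes "0 \<in> S" "\<And>x y. x \<in> S \<Longrightarrow> y \<in> S \<Longrightarrow> x + y \<in> S"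
    and irreducible: "\<And>x y. x \<in> S \<Longrightarrow> y \<in> S \<Longrightarrow> x \<noteq> 0 \<Longrightarrow> y \<noteq> 0 \<Longrightarrow> x + y \<noteq> g"
    and "g \<noteq> 0" "B \<subseteq> S - {g}"
  shows "g \<notin> nat_span B"
proof -
  have "nat_span B \<subseteq> S - {g}"
  proof (rule nat_span_least)
    fix x y assume "x \<in> S - {g}" "y \<in> S - {g}"
    then show "x + y \<in> S - {g}"
      using assms(2) irreducible by (cases "x = 0"; cases "y = 0") auto
  qed (use assms in auto)
  then show ?thesis by blast
qed

text \<open>Every \<open>x \<ge> s\<close> is congruent modulo \<open>m\<close> to \<open>s\<close>, a multiple of \<open>m\<close>, or to one of the
  generators \<open>s + 1, \<dots>, s + m - 1\<close>, which form the remaining residue classes.\<close>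

lemma nat_span_interval_generators:
  fixes m s :: nat
  assumes "m > 0" "m dvd s"
    and "S = nat_span (insert m {s + 1..s + m - 1})"
    and closed: "0 \<in> S" "\<And>x y. x \<in> S \<Longrightarrow> y \<in> S \<Longrightarrow> x + y \<in> S"
  shows "S = {x. m dvd x \<or> s \<le> x}"
proof
  show "S \<subseteq> {x. m dvd x \<or> s \<le> x}"
    unfolding assms(3) by (rule nat_span_least) auto
next
  have multiples: "n * m \<in> S" for n
    using multiple_in_additive_set[OF closed] generator_in_nat_span assms(3) by blast
  show "{x. m dvd x \<or> s \<le> x} \<subseteq> S"
  proof
    fix x assume x: "x \<in> {x. m dvd x \<or> s \<le> x}"
    show "x \<in> S"
    proof (cases "m dvd x")
      case True
      then show ?thesis using multiples by (metis dvd_def mult.commute)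
    next
      case False
      define r where "r = (x - s) mod m"
      have "s \<le> x" using x False by simp
      then have decomp: "x = (s + r) + (x - s) div m * m"
        unfolding r_def by (simp add: div_mult_mod_eq add.assoc)
      have "r \<noteq> 0"
        using False assms(2) \<open>s \<le> x\<close> unfolding r_def
        by (metis dvd_diffD mod_0_imp_dvd)
      moreover have "r < m" using assms(1) unfolding r_def by simp
      ultimately have "s + r \<in> S"
        unfolding assms(3) by (intro generator_in_nat_span) auto
      then show ?thesis using decomp multiples closed(2) by metis
    qed
  qed
qed

lemma pseudo_frobenius_multiples_Un_atLeast:
  fixes m s :: nat
  assumes "m \<ge> 2" "m dvd s" "s > 0" and S: "S = {x. m dvd x \<or> s \<le> x}"
  shows "pseudo_frobenius S = {int s - int m + 1..int s - 1}"
proof -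
  have "m \<le> s" using assms(2,3) by (simp add: dvd_imp_le)
  have image_S: "z \<in> int ` S \<longleftrightarrow> 0 \<le> z \<and> (int m dvd z \<or> int s \<le> z)" for z
  proof
    assume "z \<in> int ` S"
    then show "0 \<le> z \<and> (int m dvd z \<or> int s \<le> z)" using S by auto
  next
    assume z: "0 \<le> z \<and> (int m dvd z \<or> int s \<le> z)"
    then obtain n where "z = int n" by (metis nonneg_int_cases)
    then show "z \<in> int ` S" using z S by simp
  qed
  show ?thesis
  proof (intro equalityI subsetI)
    fix z assume "z \<in> pseudo_frobenius S"
    then have gap: "z \<notin> int ` S" and shift: "\<And>x. x \<in> S \<Longrightarrow> x \<noteq> 0 \<Longrightarrow> z + int x \<in> int ` S"
      unfolding pseudo_frobenius_def by auto
    have zm: "0 \<le> z + int m" "int m dvd z + int m \<or> int s \<le> z + int m"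
      using shift[of m] assms(1) S image_S by auto
    have "\<not> int m dvd z"
    proof
      assume "int m dvd z"
      with gap image_S have "z < 0" by force
      have "int m dvd z + int m" using \<open>int m dvd z\<close> by simp
      with zm(1) \<open>z < 0\<close> have "z = - int m"
        using zdvd_not_zless[of "z + int m" "int m"] by force
      then have "int s + 1 - int m \<in> int ` S" using shift[of "s + 1"] S by (simp add: algebra_simps)
      then have "int m dvd int s + 1 - int m" using image_S assms(1) by simp
      then have "int m dvd int s + 1" by (metis diff_add_cancel dvd_add dvd_refl)
      moreover have "int m dvd int s" using assms(2) by simp
      ultimately have "int m dvd 1" using dvd_add_right_iff by blast
      then show False using assms(1) by simp
    qed
    then have "int s \<le> z + int m" using zm(2) by simp
    moreover have "z + int m \<noteq> int s"
      using \<open>\<not> int m dvd z\<close> assms(2) by (metis dvd_add_left_iff dvd_refl int_dvd_int_iff)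
    moreover have "z < int s" using gap image_S by force
    ultimately show "z \<in> {int s - int m + 1..int s - 1}" by auto
  next
    fix z assume z: "z \<in> {int s - int m + 1..int s - 1}"
    have "\<not> int m dvd z"
    proof
      assume "int m dvd z"
      moreover have "int m dvd int s" using assms(2) by simp
      ultimately have "int m dvd int s - z" by (rule dvd_diff[rotated])
      then show False using z zdvd_not_zless[of "int s - z" "int m"] by auto
    qed
    then have "z \<notin> int ` S" using image_S z by auto
    moreover have "z + int x \<in> int ` S" if "x \<in> S" "x \<noteq> 0" for x
    proof -
      have "m \<le> x" using that S \<open>m \<le> s\<close> by (auto dest: dvd_imp_le)
      then show ?thesis using z image_S by auto
    qed
    ultimately show "z \<in> pseudo_frobenius S" unfolding pseudo_frobenius_def by blast
  qed
qed

lemma minimal_generators_multiples_Un_atLeast: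
  fixes m s :: nat
  assumes "m \<ge> 2" "m dvd s" "s > 0" and S: "S = {x. m dvd x \<or> s \<le> x}"
    and span: "nat_span (insert m {s + 1..s + m - 1}) = S"
  shows "minimal_generators S (m # [s + 1..<s + m])"
proof -
  let ?ns = "m # [s + 1..<s + m]"
  have "m \<le> s" using assms(2,3) by (simp add: dvd_imp_le)
  have set_ns: "set ?ns = insert m {s + 1..s + m - 1}" by auto
  have "sorted_wrt (<) ?ns" using \<open>m \<le> s\<close> by auto
  moreover have "nat_span (set ?ns) = S" using set_ns span by simp
  moreover have "nat_span B \<noteq> S" if B: "B \<subset> set ?ns" for B
  proof -
    obtain g where g: "g \<in> set ?ns" "g \<notin> B" using B by blast
    have "set ?ns \<subseteq> S" using set_ns S by auto
    have "x + y \<noteq> g" if "x \<in> S" "y \<in> S" "x \<noteq> 0" "y \<noteq> 0" for x y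
    proof
      assume eq: "x + y = g"
      have ge: "m \<le> x" "m \<le> y" using that S \<open>m \<le> s\<close> by (auto dest: dvd_imp_le)
      have "g \<noteq> m" using ge eq assms(1) by auto
      then have g_bounds: "s < g" "g < s + m" using g(1) by auto
      \<comment> \<open>Each summand is at least \<open>m\<close>, so each is below \<open>s\<close> and hence a multiple of \<open>m\<close>.\<close>
      then have "m dvd x" "m dvd y" using that S ge eq by auto
      then have "m dvd g - s" using eq assms(2) by auto
      then show False using g_bounds dvd_imp_le[of m "g - s"] by auto
    qed
    moreover have "0 \<in> S" "\<And>x y. x \<in> S \<Longrightarrow> y \<in> S \<Longrightarrow> x + y \<in> S" using S by auto
    moreover have "g \<noteq> 0" using g(1) assms(1) by auto
    moreover have "B \<subseteq> S - {g}" using B g(2) \<open>set ?ns \<subseteq> S\<close> by blast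
    ultimately have "g \<notin> nat_span B" by (intro irreducible_notin_nat_span)
    then show ?thesis using g(1) \<open>set ?ns \<subseteq> S\<close> by blast
  qed
  ultimately show ?thesis unfolding minimal_generators_def by blast
qed

lemma sum_three_point_row:
  fixes w :: "nat \<Rightarrow> int"
  assumes "i < m" "p < m"
  shows "(\<Sum>j<m. ((if j = i then -1 else 0) + (if j = 0 then c else 0)
      + (if j = p then d else 0)) * w j) = c * w 0 + d * w p - w i"
proof -
  have "(\<Sum>j<m. ((if j = i then -1 else 0) + (if j = 0 then c else 0)
      + (if j = p then d else 0)) * w j)
    = (\<Sum>j<m. (if j = i then - w j else 0) + (if j = 0 then c * w j else 0)
      + (if j = p then d * w j else 0))"
    by (rule sum.cong) (auto simp: algebra_simps)
  also have "\<dots> = c * w 0 + d * w p - w i"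
    using assms by (simp add: sum.distrib)
  finally show ?thesis .
qed

text \<open>Every row has at most three nonzero entries: \<open>-1\<close> on the diagonal, a multiplier \<open>c\<close> of the
  generator \<open>m\<close>, and possibly a \<open>1\<close> in one further column \<open>p\<close>. Rows and columns are counted
  from \<open>0\<close> here.\<close>

lemma rf_entry_row_sum:
  fixes w :: "nat \<Rightarrow> int"
  assumes "m dvd s" "1 \<le> k" "k < m" "i < m"
    and w0: "w 0 = int m" and w: "\<And>j. 1 \<le> j \<Longrightarrow> j < m \<Longrightarrow> w j = int s + int j"
  shows "(\<Sum>j<m. rf_entry m s k (i + 1) (j + 1) * w j) = int s - int k"
proof -
  have row: "(\<Sum>j<m. rf_entry m s k (i + 1) (j + 1) * w j) = c * w 0 + d * w p - w i"
    if "p < m" and "\<And>j. j < m \<Longrightarrow> rf_entry m s k (i + 1) (j + 1) =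
      (if j = i then -1 else 0) + (if j = 0 then c else 0) + (if j = p then d else 0)"
    for c d p
    using sum_three_point_row[OF assms(4) that(1), of c d w] that(2)
    by (metis (no_types, lifting) lessThan_iff sum.cong)
  obtain q where q: "s = m * q" using assms(1) by blast
  have quotients: "2 * int s div int m = 2 * int q" "int s div int m = int q"
    "(int s - int m) div int m = int q - 1"
  proof -
    have "int m \<noteq> 0" using assms(2,3) by simp
    have "2 * int s = int m * (2 * int q)" "int s = int m * int q"
      "int s - int m = int m * (int q - 1)"
      using q by (simp_all add: algebra_simps)
    then show "2 * int s div int m = 2 * int q" "int s div int m = int q"
      "(int s - int m) div int m = int q - 1"
      by (simp_all only: nonzero_mult_div_cancel_left[OF \<open>int m \<noteq> 0\<close>])
  qed
  consider "i = 0" | "i = k" | "0 < i" "i < k" | "k < i" by linarith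
  then show ?thesis
  proof cases
    case 1
    have "(\<Sum>j<m. rf_entry m s k (i + 1) (j + 1) * w j) = 0 * w 0 + 1 * w (m - k) - w i"
      by (rule row) (use 1 assms(2,3) in \<open>auto simp: rf_entry_def\<close>)
    then show ?thesis using 1 w0 w[of "m - k"] assms(2,3) by simp
  next
    case 2
    have "(\<Sum>j<m. rf_entry m s k (i + 1) (j + 1) * w j) = (2 * int q) * w 0 + 0 * w 0 - w i"
      by (rule row) (use 2 assms(2,3) quotients in \<open>auto simp: rf_entry_def\<close>)
    then show ?thesis using 2 w0 w[of k] assms(2,3) q by simp
  next
    case 3
    have "(\<Sum>j<m. rf_entry m s k (i + 1) (j + 1) * w j)
        = (int q - 1) * w 0 + 1 * w (i + m - k) - w i"
      by (rule row) (use 3 assms(2,3) quotients in \<open>auto simp: rf_entry_def\<close>)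
    then show ?thesis
      using 3 w0 w[of "i + m - k"] w[of i] assms(2,3) q by (simp add: algebra_simps)
  next
    case 4
    have "(\<Sum>j<m. rf_entry m s k (i + 1) (j + 1) * w j) = int q * w 0 + 1 * w (i - k) - w i"
      by (rule row) (use 4 assms(2-4) quotients in \<open>auto simp: rf_entry_def\<close>)
    then show ?thesis
      using 4 w0 w[of "i - k"] w[of i] assms(2-4) q by (simp add: algebra_simps)
  qed
qed

lemma rf_entry_nonneg:
  assumes "m \<le> s" "i \<noteq> j"
  shows "rf_entry m s k i j \<ge> 0"
  using assms by (auto simp: rf_entry_def div_int_pos_iff)

theorem proposition4p2:
  fixes m s :: nat and S :: "nat set"
  assumes "m \<ge> 2"
    and "S = nat_span (insert m {s + 1..s + m - 1})"
    and "numerical_semigroup S"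
    and "arf S"
    and "nsg_multiplicity S = m"
    and "conductor S = int s"
    and "s mod m = 0"
  shows "pseudo_frobenius S = {int s - int m + 1..int s - 1} \<and>
    (\<forall>k\<in>{1..m - 1}.
       row_factorization_matrix S (m # [s + 1..<s + m]) (int s - int k) (rf_mat m s k))"
proof -
  let ?ns = "m # [s + 1..<s + m]"
  have "m dvd s" using assms(7) by auto
  have "s \<noteq> 0"
  proof
    assume "s = 0"
    then have "1 \<in> S" unfolding assms(2) using assms(1) by (intro generator_in_nat_span) auto
    then have "nsg_multiplicity S \<le> 1" unfolding nsg_multiplicity_def by (intro Least_le) simp
    then show False using assms(1,5) by simp
  qed
  then have "s > 0" "m \<le> s" using \<open>m dvd s\<close> by (auto dest: dvd_imp_le)
  have S: "S = {x. m dvd x \<or> s \<le> x}"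
    using assms(1,3) \<open>m dvd s\<close>
    by (intro nat_span_interval_generators[OF _ _ assms(2)]) (auto simp: numerical_semigroup_def)
  have PF: "pseudo_frobenius S = {int s - int m + 1..int s - 1}"
    using pseudo_frobenius_multiples_Un_atLeast[OF assms(1) \<open>m dvd s\<close> \<open>s > 0\<close> S] .
  have gens: "minimal_generators S ?ns"
    using minimal_generators_multiples_Un_atLeast[OF assms(1) \<open>m dvd s\<close> \<open>s > 0\<close> S]
      assms(2) by simp
  have len: "length ?ns = m" using assms(1) by simp
  have "row_factorization_matrix S ?ns (int s - int k) (rf_mat m s k)" if "k \<in> {1..m - 1}" for k
  proof -
    have k: "1 \<le> k" "k < m" using that assms(1) by auto
    have row_sum: "int s - int k = (\<Sum>j<m. rf_mat m s k $$ (i, j) * int (?ns ! j))"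
      if "i < m" for i
    proof -
      have "(\<Sum>j<m. rf_mat m s k $$ (i, j) * int (?ns ! j))
          = (\<Sum>j<m. rf_entry m s k (i + 1) (j + 1) * int (?ns ! j))"
        using that by (intro sum.cong) (auto simp: rf_mat_def)
      also have "\<dots> = int s - int k"
        by (rule rf_entry_row_sum) (use \<open>m dvd s\<close> k that in \<open>auto simp: nth_Cons'\<close>)
      finally show ?thesis by simp
    qed
    have "int s - int k \<in> pseudo_frobenius S" using PF k by auto
    moreover have "rf_mat m s k \<in> carrier_mat m m" by (simp add: rf_mat_def)
    moreover have "rf_mat m s k $$ (i, i) = -1" if "i < m" for i
      using that by (simp add: rf_mat_def rf_entry_def)
    moreover have "rf_mat m s k $$ (i, j) \<ge> 0" if "i < m" "j < m" "j \<noteq> i" for i j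
      using that rf_entry_nonneg[OF \<open>m \<le> s\<close>] by (simp add: rf_mat_def)
    ultimately show ?thesis
      unfolding row_factorization_matrix_def len using gens row_sum by blast
  qed
  then show ?thesis using PF by blast
qed

end
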